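(* Let $f : \mathbb{C} \to \mathbb{C}$ be an entire holomorphic function. Then there exists an entire holomorphic function $g : \mathbb{C} \to \mathbb{C}$ such that $$f(z) = g(z+1) - g(z) \quad \text{for all } z \in \mathbb{C}.$$ *)

theory Defs
  imports "HOL-Complex_Analysis.Complex_Analysis"
begin

end

theory Submission
  imports Defs
begin

text \<open>
  For a monomial \<open>z ^ n\<close> a solution of the difference equation is \<open>n!\<close> times the Cauchy
  integral of \<open>exp (z * w) / ((exp w - 1) * w ^ (n + 1))\<close> over a circle about the origin, since
  passing from \<open>z\<close> to \<open>z + 1\<close> multiplies the integrand by \<open>exp w\<close> and the difference is
  \<open>n!\<close> times the \<open>n\<close>-th Taylor coefficient of \<open>exp (z * w)\<close> in \<open>w\<close>. Taking the radius
  \<open>(2 * n + 1) * pi\<close> keeps the circle away from the zeros of \<open>exp w - 1\<close> and makes the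
  solution grow at most geometrically in \<open>n\<close> on every disc. The Taylor coefficients of an entire
  function decay faster than any geometric sequence, so the solutions can be superposed.
\<close>

lemma higher_deriv_exp_mult:
  fixes c :: complex
  shows "(deriv ^^ n) (\<lambda>w. exp (c * w)) = (\<lambda>w. c ^ n * exp (c * w))"
proof (induction n)
  case (Suc n)
  have "deriv (\<lambda>w. c ^ n * exp (c * w)) w = c ^ Suc n * exp (c * w)" for w
    by (rule DERIV_imp_deriv) (auto intro!: derivative_eq_intros)
  then show ?case
    using Suc by auto
qed auto

lemma has_contour_integral_exp_over_power:
  assumes "0 < r"
  shows "((\<lambda>w. exp (z * w) / w ^ Suc n) has_contour_integral 2 * pi * \<i> / fact n * z ^ n)
           (circlepath 0 r)"
proof -
  have "((\<lambda>w. exp (z * w) / (w - 0) ^ Suc n) has_contour_integral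
          2 * pi * \<i> / fact n * (deriv ^^ n) (\<lambda>w. exp (z * w)) 0) (circlepath 0 r)"
    using assms by (intro Cauchy_has_contour_integral_higher_derivative_circlepath)
      (auto intro!: continuous_intros holomorphic_intros)
  then show ?thesis
    by (simp add: higher_deriv_exp_mult)
qed

text \<open>Parametrising the circle over [0, 1] gives a kernel holomorphic in \<open>z\<close> and
  jointly continuous, so one may differentiate under the integral sign. Only continuity of
  \<open>h\<close> on the circle matters, so poles inside are harmless.\<close>

lemma holomorphic_contour_integral_exp_mult:
  fixes h :: "complex \<Rightarrow> complex"
  assumes h: "continuous_on (sphere 0 r) h" and r: "0 \<le> r"
  shows "(\<lambda>z. contour_integral (circlepath 0 r) (\<lambda>w. exp (z * w) * h w)) holomorphic_on UNIV"
proof -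
  define p where "p = circlepath 0 r"
  define k where "k t = h (p t) * (2 * pi * \<i> * r * exp (2 * pi * \<i> * t))" for t :: real
  have p: "continuous_on {0..1} p"
    unfolding p_def by (simp flip: path_def)
  have "p ` {0..1} = sphere 0 r"
    using r by (simp add: p_def flip: path_image_def)
  then have "continuous_on {0..1} (\<lambda>t. h (p t))"
    using continuous_on_compose2[OF h p] by simp
  then have k: "continuous_on {0..1} k"
    unfolding k_def by (intro continuous_intros)
  have "(\<lambda>z. integral (cbox 0 1) (\<lambda>t. exp (z * p t) * k t)) holomorphic_on UNIV"
  proof (rule leibniz_rule_holomorphic)
    show "((\<lambda>z. exp (z * p t) * k t) has_field_derivative p t * exp (z * p t) * k t) (at z)" for z t
      by (auto intro!: derivative_eq_intros)
    show "(\<lambda>t. exp (z * p t) * k t) integrable_on cbox 0 1" for z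
      by (rule integrable_continuous) (auto intro!: continuous_intros p k)
    have "continuous_on (UNIV \<times> {0..1}) (\<lambda>x. p (snd x))" "continuous_on (UNIV \<times> {0..1}) (\<lambda>x. k (snd x))"
      by (auto intro!: continuous_on_compose2[OF p] continuous_on_compose2[OF k] continuous_intros)
    then show "continuous_on (UNIV \<times> cbox 0 1) (\<lambda>(z, t). p t * exp (z * p t) * k t)"
      by (auto simp: case_prod_beta intro!: continuous_intros)
  qed auto
  moreover have "contour_integral p (\<lambda>w. exp (z * w) * h w)
      = integral (cbox 0 1) (\<lambda>t. exp (z * p t) * k t)" for z
    unfolding contour_integral_integral
    by (simp, rule integral_cong) (simp add: p_def k_def vector_derivative_circlepath)
  ultimately show ?thesis
    by (simp add: p_def)
qed

text \<open>Away from the imaginary axis the modulus \<open>exp (Re w)\<close> alone is far from 1;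
  near it the argument of \<open>exp w\<close> decides. The bound is uniform in \<open>n\<close>, as
  the growth estimate requires.\<close>

lemma norm_exp_minus_1_ge_half:
  fixes w :: complex
  assumes w: "norm w = (2 * real n + 1) * pi"
  shows "1 / 2 \<le> norm (exp w - 1)"
proof -
  have exp1: "2 \<le> exp (1::real)"
    using exp_ge_add_one_self[of 1] by simp
  have norm_ge: "\<bar>exp (Re w) - 1\<bar> \<le> norm (exp w - 1)"
    using norm_triangle_ineq3[of "exp w" 1] by (simp add: norm_exp_eq_Re)
  consider "1 \<le> Re w" | "Re w \<le> -1" | "\<bar>Re w\<bar> < 1"
    by linarith
  then show ?thesis
  proof cases
    case 1
    then have "exp 1 \<le> exp (Re w)"
      by simp
    with exp1 norm_ge show ?thesis
      by linarith
  next
    case 2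
    then have "exp (Re w) \<le> exp (-1)"
      by simp
    also have "\<dots> \<le> 1 / 2"
      using exp1 by (simp add: exp_minus field_simps)
    finally show ?thesis
      using norm_ge by linarith
  next
    case 3
    \<comment> \<open>Here the imaginary part is within \<open>1 < pi / 2\<close> of an odd multiple of \<open>pi\<close>,
      so \<open>exp w\<close> lies in the left half plane.\<close>
    define d where "d = (2 * real n + 1) * pi - \<bar>Im w\<bar>"
    \<comment> \<open>These come from \<open>\<bar>Im w\<bar> \<le> norm w\<close> and
      \<open>norm w \<le> \<bar>Re w\<bar> + \<bar>Im w\<bar>\<close>.\<close>
    have "0 \<le> d" "d \<le> 1"
      using abs_Im_le_cmod[of w] cmod_le[of w] w 3 by (auto simp: d_def)
    then have "0 \<le> cos d"
      using pi_gt3 by (intro cos_ge_zero) auto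
    have "cos (Im w) = cos \<bar>Im w\<bar>"
      by simp
    also have "\<bar>Im w\<bar> = (2 * real n + 1) * pi - d"
      by (simp add: d_def)
    also have "cos \<dots> = - cos d"
      by (simp add: cos_diff distrib_right cos_add sin_add)
    finally have "Re (exp w) \<le> 0"
      using \<open>0 \<le> cos d\<close> by (simp add: Re_exp)
    then show ?thesis
      using abs_Re_le_cmod[of "exp w - 1"] by simp
  qed
qed

text \<open>The residue at 0 contributes the Bernoulli polynomial of degree \<open>n + 1\<close>
  divided by \<open>n + 1\<close>. The other enclosed poles, at \<open>2 * pi * \<i> * k\<close>
  with \<open>0 < \<bar>k\<bar> \<le> n\<close>, contribute 1-periodic exponentials in
  \<open>z\<close>, which do not affect the difference.\<close>

definition monomial_solution :: "nat \<Rightarrow> complex \<Rightarrow> complex" where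
  "monomial_solution n z = fact n / (2 * pi * \<i>) *
     contour_integral (circlepath 0 ((2 * real n + 1) * pi))
       (\<lambda>w. exp (z * w) * (1 / ((exp w - 1) * w ^ Suc n)))"

context
  fixes n :: nat and r :: real and h :: "complex \<Rightarrow> complex"
  defines "r \<equiv> (2 * real n + 1) * pi"
    and "h \<equiv> (\<lambda>w. 1 / ((exp w - 1) * w ^ Suc n))"
begin

private lemma r_pos: "0 < r"
  by (simp add: r_def add_pos_nonneg)

private lemma exp_neq_1: "norm w = r \<Longrightarrow> exp w \<noteq> 1" for w :: complex
  using norm_exp_minus_1_ge_half[of w n] by (auto simp: r_def)

private lemma continuous_h: "continuous_on (sphere 0 r) h"
  unfolding h_def using r_pos exp_neq_1[OF sym] by (auto intro!: continuous_intros)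

private lemma integrable: "(\<lambda>w. exp (z * w) * h w) contour_integrable_on circlepath 0 r"
  using r_pos continuous_h
  by (intro contour_integrable_continuous_circlepath) (auto intro!: continuous_intros)

private lemma monomial_solution_eq:
  "monomial_solution n z
     = fact n / (2 * pi * \<i>) * contour_integral (circlepath 0 r) (\<lambda>w. exp (z * w) * h w)"
  by (simp add: monomial_solution_def r_def h_def)

lemma holomorphic_monomial_solution: "monomial_solution n holomorphic_on UNIV"
  unfolding monomial_solution_eq using r_pos continuous_h
  by (auto intro!: holomorphic_intros holomorphic_contour_integral_exp_mult)

lemma monomial_solution_diff: "monomial_solution n (z + 1) - monomial_solution n z = z ^ n"
proof -
  have "contour_integral (circlepath 0 r) (\<lambda>w. exp ((z + 1) * w) * h w)
      - contour_integral (circlepath 0 r) (\<lambda>w. exp (z * w) * h w)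
      = contour_integral (circlepath 0 r) (\<lambda>w. exp ((z + 1) * w) * h w - exp (z * w) * h w)"
    by (rule contour_integral_diff[symmetric]; rule integrable)
  also have "\<dots> = contour_integral (circlepath 0 r) (\<lambda>w. exp (z * w) / w ^ Suc n)"
  proof (rule contour_integral_cong)
    fix w assume "w \<in> path_image (circlepath 0 r)"
    then have "exp w \<noteq> 1"
      using r_pos exp_neq_1 by simp
    have "exp ((z + 1) * w) * h w - exp (z * w) * h w = exp (z * w) * ((exp w - 1) * h w)"
      by (simp add: algebra_simps exp_add)
    also have "(exp w - 1) * h w = 1 / w ^ Suc n"
      using \<open>exp w \<noteq> 1\<close> by (simp add: h_def)
    finally show "exp ((z + 1) * w) * h w - exp (z * w) * h w = exp (z * w) / w ^ Suc n"
      by simp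
  qed simp
  also have "\<dots> = 2 * pi * \<i> / fact n * z ^ n"
    by (rule contour_integral_unique[OF has_contour_integral_exp_over_power[OF r_pos]])
  finally have diff: "contour_integral (circlepath 0 r) (\<lambda>w. exp ((z + 1) * w) * h w)
      - contour_integral (circlepath 0 r) (\<lambda>w. exp (z * w) * h w) = 2 * pi * \<i> / fact n * z ^ n" .
  show ?thesis
    unfolding monomial_solution_eq right_diff_distrib[symmetric] diff by simp
qed

text \<open>This is the standard estimate, length of the circle times maximum of the integrand. For
  fixed \<open>R\<close> the result is geometric in \<open>n\<close>, because the power of
  \<open>r\<close> in the denominator absorbs \<open>fact n\<close>.\<close>

lemma norm_monomial_solution_le:
  assumes "norm z \<le> R"
  shows "norm (monomial_solution n z) \<le> 2 * exp (R * ((2 * real n + 1) * pi))"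
proof -
  have bound: "norm (exp (z * w) * h w) \<le> 2 * exp (R * r) / r ^ Suc n" if "norm (w - 0) = r" for w
  proof -
    have "norm (exp (z * w)) \<le> exp (norm (z * w))"
      by (rule norm_exp)
    also have "\<dots> \<le> exp (R * r)"
      using assms that r_pos by (simp add: norm_mult mult_right_mono)
    finally have 1: "norm (exp (z * w)) \<le> exp (R * r)" .
    have half: "1 / 2 \<le> norm (exp w - 1)"
      using that norm_exp_minus_1_ge_half[of w n] by (simp add: r_def)
    have "norm (h w) = 1 / norm (exp w - 1) / r ^ Suc n"
      using that by (simp add: h_def norm_divide norm_mult norm_power)
    also have "\<dots> \<le> 2 / r ^ Suc n"
      using half r_pos le_imp_inverse_le[OF half]
      by (intro divide_right_mono) (auto simp: inverse_eq_divide)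
    finally have 2: "norm (h w) \<le> 2 / r ^ Suc n" .
    show ?thesis
      using mult_mono[OF 1 2] by (simp add: norm_mult mult.commute)
  qed
  have "norm (contour_integral (circlepath 0 r) (\<lambda>w. exp (z * w) * h w))
      \<le> 2 * exp (R * r) / r ^ Suc n * (2 * pi * r)"
    using r_pos bound
    by (intro has_contour_integral_bound_circlepath[OF has_contour_integral_integral[OF integrable]])
      auto
  also have "\<dots> = 2 * pi * (2 * exp (R * r) / r ^ n)"
    using r_pos by simp
  finally have "norm (monomial_solution n z)
      \<le> fact n / (2 * pi) * (2 * pi * (2 * exp (R * r) / r ^ n))"
    unfolding monomial_solution_eq norm_mult
    by (intro mult_mono) (auto simp: norm_divide norm_mult)
  also have "\<dots> = fact n / r ^ n * (2 * exp (R * r))"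
    by simp
  also have "\<dots> \<le> 1 * (2 * exp (R * r))"
  proof (rule mult_right_mono)
    \<comment> \<open>The radius grows with \<open>n\<close> for this purpose:
      \<open>fact n \<le> n ^ n \<le> r ^ n\<close>.\<close>
    have "real n \<le> r"
      unfolding r_def using pi_gt3 mult_mono[of "real n" "2 * real n + 1" 1 pi] by simp
    then have "fact n \<le> r ^ n"
      using fact_le_power[of n, where 'a = real] power_mono[of "real n" r n] by simp
    then show "fact n / r ^ n \<le> 1"
      using r_pos by simp
  qed simp
  finally show ?thesis
    by (simp add: r_def)
qed

end

theorem lemma2:
  fixes f :: "complex \<Rightarrow> complex"
  assumes "f holomorphic_on UNIV"
  shows "\<exists>g :: complex \<Rightarrow> complex. g holomorphic_on UNIV \<and> (\<forall>z. f z = g (z + 1) - g z)"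
proof -
  define a where "a n = (deriv ^^ n) f 0 / fact n" for n
  have a: "(\<lambda>n. a n * z ^ n) sums f z" for z
    using holomorphic_power_series[of f 0 "norm z + 1" z] assms
    by (auto simp: a_def intro: holomorphic_on_subset)
  define u where "u n z = a n * monomial_solution n z" for n z
  define M where "M R n = norm (a n) * (2 * exp (R * ((2 * real n + 1) * pi)))" for R n
  have u_le: "norm (u n z) \<le> M R n" if "norm z \<le> R" for n z R
    unfolding u_def M_def norm_mult
    using norm_monomial_solution_le[OF that] by (rule mult_left_mono) simp
  have M: "summable (M R)" for R
  proof -
    \<comment> \<open>The exponential in \<open>M R n\<close> equals
      \<open>exp (R * pi) * q ^ n\<close>, so summability of \<open>M R\<close> is absolute
      convergence of the Taylor series of \<open>f\<close> at \<open>q\<close>.\<close>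
    define q where "q = exp (2 * pi * R)"
    have "summable (\<lambda>n. norm (a n * of_real q ^ n))"
      \<comment> \<open>Convergence at the larger point \<open>q + 1\<close> yields absolute
        convergence at \<open>q\<close>.\<close>
      by (rule powser_insidea[OF sums_summable[OF a[of "of_real (q + 1)"]]])
        (simp add: q_def add_pos_pos del: of_real_add)
    then have "summable (\<lambda>n. 2 * exp (R * pi) * norm (a n * of_real q ^ n))"
      by (rule summable_mult)
    also have "(\<lambda>n. 2 * exp (R * pi) * norm (a n * of_real q ^ n)) = M R"
      by (rule ext) (simp add: M_def q_def norm_mult norm_power algebra_simps exp_add
        flip: exp_of_nat_mult)
    finally show ?thesis .
  qed
  define g where "g z = (\<Sum>n. u n z)" for z
  have "g holomorphic_on UNIV"
  proof (rule holomorphic_uniform_sequence)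
    show "(\<lambda>z. \<Sum>i<n. u i z) holomorphic_on UNIV" for n
      unfolding u_def by (intro holomorphic_intros holomorphic_monomial_solution)
    show "\<exists>d>0. cball z d \<subseteq> UNIV \<and> uniform_limit (cball z d) (\<lambda>n z. \<Sum>i<n. u i z) g sequentially"
      for z
    \<comment> \<open>On the unit disc about \<open>z\<close> the series is dominated by
      \<open>M (norm z + 1)\<close>, so the Weierstrass M-test applies.\<close>
    proof (intro exI[of _ 1] conjI)
      have "norm w \<le> norm z + 1" if "w \<in> cball z 1" for w
        using that norm_triangle_sub[of w z] by (simp add: dist_norm norm_minus_commute)
      then show "uniform_limit (cball z 1) (\<lambda>n z. \<Sum>i<n. u i z) g sequentially"
        unfolding g_def by (intro Weierstrass_m_test[OF _ M] u_le)
    qed auto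
  qed auto
  moreover have "f z = g (z + 1) - g z" for z
  proof -
    have u: "(\<lambda>n. u n w) sums g w" for w
      unfolding g_def by (intro summable_sums summable_comparison_test'[OF M u_le[OF order_refl]])
    have "(\<lambda>n. a n * z ^ n) sums (g (z + 1) - g z)"
      using sums_diff[OF u[of "z + 1"] u[of z]]
      by (simp add: u_def monomial_solution_diff flip: right_diff_distrib)
    then show ?thesis
      using sums_unique2[OF a] by blast
  qed
  ultimately show ?thesis
    by blast
qed

end
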